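(* Let $d$ be a metric on $\mathbb F$ such that the sets $\{f\in\mathbb F: d(f,f_0)\geq t\}$, $t>0$, are measurable, and let $r$ be a positive constant. Suppose that the true density $f_0$ is in the Kullback-Leibler support of the prior $\Pi$, and suppose that for any $\varepsilon>0$ there exist constants $0<\alpha_\varepsilon\leq 1$ and $\beta_\varepsilon>0$ such that $$E_{f_0}\Big(\int_{\{f:\,d(f,f_0)\geq r\varepsilon\}}R_n(f)\,\Pi(df)\Big)^{\alpha_\varepsilon}\leq e^{-n\beta_\varepsilon}\quad\text{for all large } n.$$ Then the posterior $\Pi(\cdot\mid X_1,\dots,X_n)$ is exponentially consistent at $f_0$ almost surely; that is, for any $\varepsilon>0$ there exists a constant $b_\varepsilon>0$ such that $$e^{n b_\varepsilon}\,\Pi\big(f: d(f,f_0)\geq\varepsilon\mid X_1,\dots,X_n\big)\to 0$$ almost surely (with respect to $P_{f_0}^\infty$) as $n\to\infty$.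
   Context: Setting. $\mathbb X$ is a Polish space with a $\sigma$-algebra $\mathcal X$ and $\mu$ is a $\sigma$-finite measure on $\mathbb X$. $\mathbb F$ is the space of probability densities with respect to $\mu$, assumed separable for the Hellinger metric $H(f,g)=\big(\int_{\mathbb X}(\sqrt{f}-\sqrt{g})^2\,d\mu\big)^{1/2}$, and equipped with its Borel $\sigma$-algebra $\mathcal F$ (measurable subsets of $\mathbb F$ are those in $\mathcal F$). A prior $\Pi$ is a probability measure on $(\mathbb F,\mathcal F)$. Versions of densities are taken so that $(x,f)\mapsto f(x)$ is jointly measurable. $X_1,X_2,\dots$ are i.i.d. $\mathbb X$-valued with true density $f_0\in\mathbb F$; $P_{f_0}$ is the distribution with density $f_0$, $P_{f_0}^\infty$ its infinite product on $\mathbb X^\infty$, and $E_{f_0}$ is expectation with respect to $X_1,\dots,X_n$ i.i.d. with density $f_0$. Likelihood ratio: $R_n(f)=\prod_{i=1}^n f(X_i)/f_0(X_i)$. Posterior: for measurable $A\subset\mathbb F$, $$\Pi(A\mid X_1,\dots,X_n)=\frac{\int_A\prod_{i=1}^n f(X_i)\,\Pi(df)}{\int_{\mathbb F}\prod_{i=1}^n f(X_i)\,\Pi(df)}=\frac{\int_A R_n(f)\,\Pi(df)}{\int_{\mathbb F}R_n(f)\,\Pi(df)}.$$ Kullback-Leibler divergence: $K(f,g)=\int_{\mathbb X} f\log(f/g)\,d\mu$. The density $f_0$ is in the Kullback-Leibler support of $\Pi$ if $\Pi(f: K(f_0,f)<\varepsilon)>0$ for every $\varepsilon>0$. *)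

theory Defs
  imports "HOL-Probability.Probability"
begin

definition prob_density :: "'a measure \<Rightarrow> ('a \<Rightarrow> real) \<Rightarrow> bool" where
  "prob_density \<mu> f \<longleftrightarrow>
     f \<in> borel_measurable \<mu> \<and> (\<forall>x\<in>space \<mu>. 0 \<le> f x) \<and> (\<integral>\<^sup>+x. ennreal (f x) \<partial>\<mu>) = 1"

text \<open>
  Densities are identified when they agree almost everywhere. The space of densities is
  represented by a set \<open>F\<close> containing exactly one version of each class, so that evaluating
  \<open>f\<close> at \<open>x\<close> makes sense and the Hellinger distance is a metric on \<open>F\<close>.
\<close>

definition density_versions :: "'a measure \<Rightarrow> ('a \<Rightarrow> real) set \<Rightarrow> bool" where
  "density_versions \<mu> F \<longleftrightarrow>
     (\<forall>f\<in>F. prob_density \<mu> f) \<and>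
     (\<forall>g. prob_density \<mu> g \<longrightarrow> (\<exists>!f. f \<in> F \<and> (AE x in \<mu>. f x = g x)))"

definition hellinger :: "'a measure \<Rightarrow> ('a \<Rightarrow> real) \<Rightarrow> ('a \<Rightarrow> real) \<Rightarrow> real" where
  "hellinger \<mu> f g = sqrt (\<integral>x. (sqrt (f x) - sqrt (g x))\<^sup>2 \<partial>\<mu>)"

definition hellinger_topology :: "'a measure \<Rightarrow> ('a \<Rightarrow> real) set \<Rightarrow> ('a \<Rightarrow> real) topology" where
  "hellinger_topology \<mu> F = Metric_space.mtopology F (hellinger \<mu>)"

definition hellinger_borel :: "'a measure \<Rightarrow> ('a \<Rightarrow> real) set \<Rightarrow> ('a \<Rightarrow> real) measure" where
  "hellinger_borel \<mu> F = sigma F {U. openin (hellinger_topology \<mu> F) U}"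

text \<open>
  The integrand \<open>f log (f / g)\<close> with the usual conventions: it is \<open>0\<close> where \<open>f = 0\<close>, and
  \<open>\<infinity>\<close> where \<open>f > 0 = g\<close>. \<open>KL_divergence\<close> from the library is real-valued and takes the
  value \<open>0\<close> when the integral is infinite, hence the extended-real integral below. For
  densities the integral of the negative part is at most \<open>1\<close> (as \<open>f log (f / g) \<ge> f - g\<close>),
  so the difference is never \<open>\<infinity> - \<infinity>\<close>. Note that \<open>e2ennreal\<close> sends negative values to \<open>0\<close>.
\<close>

definition KL_integrand :: "('a \<Rightarrow> real) \<Rightarrow> ('a \<Rightarrow> real) \<Rightarrow> 'a \<Rightarrow> ereal" where
  "KL_integrand f g x =
     (if f x = 0 then 0 else if g x = 0 then \<infinity> else ereal (f x * ln (f x / g x)))"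

definition KL :: "'a measure \<Rightarrow> ('a \<Rightarrow> real) \<Rightarrow> ('a \<Rightarrow> real) \<Rightarrow> ereal" where
  "KL \<mu> f g = enn2ereal (\<integral>\<^sup>+x. e2ennreal (KL_integrand f g x) \<partial>\<mu>)
            - enn2ereal (\<integral>\<^sup>+x. e2ennreal (- KL_integrand f g x) \<partial>\<mu>)"

definition in_KL_support ::
    "'a measure \<Rightarrow> ('a \<Rightarrow> real) set \<Rightarrow> ('a \<Rightarrow> real) measure \<Rightarrow> ('a \<Rightarrow> real) \<Rightarrow> bool" where
  "in_KL_support \<mu> F prior f0 \<longleftrightarrow>
     (\<forall>\<epsilon>>0::real. emeasure prior {f\<in>F. KL \<mu> f0 f < ereal \<epsilon>} > 0)"

text \<open>
  A sample is a sequence \<open>\<omega>\<close>; the first \<open>n\<close> observations are \<open>\<omega> 0, \<dots>, \<omega> (n - 1)\<close>.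
\<close>

definition sample_measure :: "'a measure \<Rightarrow> ('a \<Rightarrow> real) \<Rightarrow> (nat \<Rightarrow> 'a) measure" where
  "sample_measure \<mu> f0 = PiM UNIV (\<lambda>_. density \<mu> (\<lambda>x. ennreal (f0 x)))"

definition likelihood :: "nat \<Rightarrow> (nat \<Rightarrow> 'a) \<Rightarrow> ('a \<Rightarrow> real) \<Rightarrow> real" where
  "likelihood n \<omega> f = (\<Prod>i<n. f (\<omega> i))"

definition likelihood_ratio :: "('a \<Rightarrow> real) \<Rightarrow> nat \<Rightarrow> (nat \<Rightarrow> 'a) \<Rightarrow> ('a \<Rightarrow> real) \<Rightarrow> real" where
  "likelihood_ratio f0 n \<omega> f = (\<Prod>i<n. f (\<omega> i) / f0 (\<omega> i))"

definition posterior ::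
    "('a \<Rightarrow> real) measure \<Rightarrow> nat \<Rightarrow> (nat \<Rightarrow> 'a) \<Rightarrow> ('a \<Rightarrow> real) set \<Rightarrow> ennreal" where
  "posterior prior n \<omega> A =
     (\<integral>\<^sup>+f\<in>A. ennreal (likelihood n \<omega> f) \<partial>prior) / (\<integral>\<^sup>+f. ennreal (likelihood n \<omega> f) \<partial>prior)"

definition ennpowr :: "ennreal \<Rightarrow> real \<Rightarrow> ennreal" where
  "ennpowr x a = (if x = \<top> then \<top> else ennreal (enn2real x powr a))"

end

theory Submission
  imports Defs "HOL-Real_Asymp.Real_Asymp"
begin

text \<open>
  Write \<open>A = {f. d f f0 \<ge> \<epsilon>}\<close>. Up to a factor that cancels, the posterior mass of \<open>A\<close> is the
  quotient of \<open>N n = \<integral>\<^sub>A R\<^sub>n d\<Pi>\<close> and the evidence \<open>D n = \<integral> R\<^sub>n d\<Pi>\<close>, and the two are controlled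
  separately.

  The hypothesis with \<open>\<epsilon> / r\<close> in place of \<open>\<epsilon>\<close> concerns exactly this \<open>A\<close>. It bounds the
  \<open>\<alpha>\<close>-th moment of \<open>N n\<close> by \<open>exp (- n \<beta>)\<close>, so Markov's inequality at level
  \<open>exp (- n \<beta> / 2)\<close> and the Borel-Cantelli lemma give
  \<open>N n \<le> exp (- n \<beta> / (2 \<alpha>))\<close> eventually, almost surely (\<open>AE_set_integral_decays\<close>).

  The Kullback-Leibler support keeps the evidence from being exponentially small: for every
  \<open>c > 0\<close>, \<open>exp (n c) D n\<close> tends to infinity almost surely (\<open>AE_evidence_exceeds\<close>). Indeed, if
  \<open>K(f0, f) < c\<close> then \<open>- log R\<^sub>n f\<close> is a sum of \<open>n\<close> i.i.d. terms of mean \<open>K(f0, f)\<close>, so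
  \<open>exp (n c) R\<^sub>n f\<close> tends to infinity almost surely. By Fubini, almost every sample has this
  property for almost all such \<open>f\<close> simultaneously; these form a set of positive prior mass, and
  Fatou's lemma passes the divergence on to the integral. Choosing \<open>c\<close> below \<open>\<beta> / (2 \<alpha>)\<close>
  leaves an exponential rate for the quotient.

  Of the strong law of large numbers this uses one half only: a random walk with integrable
  increments of negative mean is almost surely bounded above (\<open>AE_partial_sums_bdd_above\<close>).
  That half has a short direct proof, by a maximal inequality for the reflected walk.
\<close>

section \<open>Random walks with negative drift\<close>

text \<open>
  \<open>reflected_walk Z n \<omega>\<close> is the maximum of the partial sums \<open>\<Sum>i<k. Z (\<omega> i)\<close> for \<open>k \<le> n\<close>.
  The recursion splits off the first observation, so that prepending an independent observation
  to a sample acts on it in one explicit step.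
\<close>

primrec reflected_walk :: "('a \<Rightarrow> real) \<Rightarrow> nat \<Rightarrow> (nat \<Rightarrow> 'a) \<Rightarrow> real" where
  "reflected_walk Z 0 \<omega> = 0"
| "reflected_walk Z (Suc n) \<omega> = max 0 (Z (\<omega> 0) + reflected_walk Z n (\<lambda>i. \<omega> (Suc i)))"

lemma reflected_walk_case_nat [simp]:
  "reflected_walk Z (Suc n) (case_nat x \<omega>) = max 0 (Z x + reflected_walk Z n \<omega>)"
  by simp

lemma reflected_walk_mono: "reflected_walk Z n \<omega> \<le> reflected_walk Z (Suc n) \<omega>"
proof (induction n arbitrary: \<omega>)
  case (Suc n)
  from Suc.IH[of "\<lambda>i. \<omega> (Suc i)"] show ?case by simp
qed simp

lemma reflected_walk_nonneg: "0 \<le> reflected_walk Z n \<omega>"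
  by (cases n) simp_all

lemma partial_sum_le_reflected_walk: "(\<Sum>i<n. Z (\<omega> i)) \<le> reflected_walk Z n \<omega>"
proof (induction n arbitrary: \<omega>)
  case (Suc n)
  from Suc.IH[of "\<lambda>i. \<omega> (Suc i)"] show ?case
    by (simp add: sum.lessThan_Suc_shift del: sum.lessThan_Suc)
qed simp

definition walk_unbounded :: "('a \<Rightarrow> real) \<Rightarrow> (nat \<Rightarrow> 'a) \<Rightarrow> bool" where
  "walk_unbounded Z \<omega> \<longleftrightarrow> (\<forall>k::nat. \<exists>n. real k < reflected_walk Z n \<omega>)"

lemma walk_unbounded_eventually:
  assumes "walk_unbounded Z \<omega>"
  shows "\<forall>\<^sub>F n in sequentially. K < reflected_walk Z n \<omega>"
proof -
  obtain k :: nat where "K \<le> real k" using real_arch_simple by blast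
  moreover obtain m where "real k < reflected_walk Z m \<omega>"
    using assms unfolding walk_unbounded_def by blast
  moreover have "reflected_walk Z m \<omega> \<le> reflected_walk Z n \<omega>" if "m \<le> n" for n
    using that by (rule lift_Suc_mono_le[of "\<lambda>n. reflected_walk Z n \<omega>", OF reflected_walk_mono])
  ultimately show ?thesis
    by (intro eventually_sequentiallyI[of m]) force
qed

text \<open>
  Unboundedness is unaffected by the first observation. This is what makes the event independent
  of that observation in the proof below.
\<close>
lemma walk_unbounded_case_nat: "walk_unbounded Z (case_nat x \<omega>) \<longleftrightarrow> walk_unbounded Z \<omega>"
proof
  assume unb: "walk_unbounded Z (case_nat x \<omega>)"
  show "walk_unbounded Z \<omega>" unfolding walk_unbounded_def
  proof
    fix k :: nat
    have "\<forall>\<^sub>F n in sequentially. \<bar>Z x\<bar> + real k < reflected_walk Z n (case_nat x \<omega>)"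
      by (rule walk_unbounded_eventually[OF unb])
    then obtain n where "\<bar>Z x\<bar> + real k < reflected_walk Z n (case_nat x \<omega>)"
      unfolding eventually_sequentially by blast
    then show "\<exists>n. real k < reflected_walk Z n \<omega>"
      by (cases n) (auto split: if_splits simp: max_def intro: exI[of _ "n - 1"])
  qed
next
  assume unb: "walk_unbounded Z \<omega>"
  show "walk_unbounded Z (case_nat x \<omega>)" unfolding walk_unbounded_def
  proof
    fix k :: nat
    have "\<forall>\<^sub>F n in sequentially. real k - Z x < reflected_walk Z n \<omega>"
      by (rule walk_unbounded_eventually[OF unb])
    then obtain n where "real k - Z x < reflected_walk Z n \<omega>"
      unfolding eventually_sequentially by blast
    then show "\<exists>n. real k < reflected_walk Z n (case_nat x \<omega>)"
      by (intro exI[of _ "Suc n"]) simp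
  qed
qed

context sequence_space
begin

lemma measurable_sequence_shift [measurable]:
  "(\<lambda>\<omega> i. \<omega> (Suc i)) \<in> measurable S S"
  by (rule measurable_PiM_single') (auto simp: space_PiM)

lemma measurable_case_nat_pair [measurable]:
  "(\<lambda>p. case_nat (fst p) (snd p)) \<in> measurable (M \<Otimes>\<^sub>M S) S"
  by measurable

lemma measurable_reflected_walk [measurable]:
  assumes [measurable]: "Z \<in> borel_measurable M"
  shows "reflected_walk Z n \<in> borel_measurable S"
proof (induction n)
  case (Suc n)
  note Suc [measurable]
  show ?case by simp
qed simp

lemma measurable_walk_unbounded [measurable]:
  assumes [measurable]: "Z \<in> borel_measurable M"
  shows "Measurable.pred S (walk_unbounded Z)"
  unfolding walk_unbounded_def by measurable

sublocale head_tail: pair_prob_space M S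
  ..

text \<open>
  Prepending one observation to an independent sample gives a sample again; integrals over samples
  can thus be computed over pairs of a first observation and a remainder.
\<close>
lemma integral_case_nat:
  fixes g :: "(nat \<Rightarrow> 'a) \<Rightarrow> real"
  assumes [measurable]: "g \<in> borel_measurable S"
  shows "(\<integral>p. g (case_nat (fst p) (snd p)) \<partial>(M \<Otimes>\<^sub>M S)) = (\<integral>\<omega>. g \<omega> \<partial>S)"
    and "integrable (M \<Otimes>\<^sub>M S) (\<lambda>p. g (case_nat (fst p) (snd p))) \<longleftrightarrow> integrable S g"
proof -
  have eq: "S = distr (M \<Otimes>\<^sub>M S) S (\<lambda>p. case_nat (fst p) (snd p))"
    using PiM_iter by (simp add: split_beta')
  show "(\<integral>p. g (case_nat (fst p) (snd p)) \<partial>(M \<Otimes>\<^sub>M S)) = (\<integral>\<omega>. g \<omega> \<partial>S)"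
    by (subst (2) eq, subst integral_distr) simp_all
  show "integrable (M \<Otimes>\<^sub>M S) (\<lambda>p. g (case_nat (fst p) (snd p))) \<longleftrightarrow> integrable S g"
    by (subst (2) eq, subst integrable_distr_eq) simp_all
qed

lemma integrable_head:
  fixes Z :: "'a \<Rightarrow> real"
  assumes "integrable M Z"
  shows "integrable (M \<Otimes>\<^sub>M S) (\<lambda>p. Z (fst p))"
  using assms by (intro head_tail.Fubini_integrable) auto

lemma integrable_tail:
  fixes g :: "(nat \<Rightarrow> 'a) \<Rightarrow> real"
  assumes "integrable S g"
  shows "integrable (M \<Otimes>\<^sub>M S) (\<lambda>p. g (snd p))"
  using assms by (intro head_tail.Fubini_integrable) auto

lemma integral_tail:
  fixes g :: "(nat \<Rightarrow> 'a) \<Rightarrow> real"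
  assumes "integrable S g"
  shows "(\<integral>p. g (snd p) \<partial>(M \<Otimes>\<^sub>M S)) = (\<integral>\<omega>. g \<omega> \<partial>S)"
  using head_tail.integral_fst'[OF integrable_tail[OF assms]] by (simp add: M.prob_space)

lemma integrable_reflected_walk:
  assumes Z: "integrable M Z"
  shows "integrable S (reflected_walk Z n)"
proof (induction n)
  case (Suc n)
  have [measurable]: "Z \<in> borel_measurable M" using Z by simp
  have "integrable (M \<Otimes>\<^sub>M S) (\<lambda>p. max 0 (Z (fst p) + reflected_walk Z n (snd p)))"
    by (intro integrable_max integrable_zero Bochner_Integration.integrable_add
        integrable_head integrable_tail Z Suc)
  then show ?case
    by (subst integral_case_nat(2)[symmetric]) auto
qed (simp add: integrable_zero)

text \<open>
  Let \<open>W n\<close> be the reflected walk and \<open>A\<close> the event that it is unbounded. If \<open>x\<close> is prepended to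
  \<open>\<omega>\<close>, then \<open>W (n + 1)\<close> of the extended sample exceeds \<open>W n \<omega>\<close> by exactly
  \<open>max (- W n \<omega>) (Z x)\<close>. As \<open>W n\<close> is increasing in \<open>n\<close>, and prepending preserves both the sample
  distribution and \<open>A\<close>, the integral of this excess over \<open>A\<close> is nonnegative. On \<open>A\<close> we have
  \<open>W n \<omega> \<longlonglongrightarrow> \<infinity>\<close>, so the excess is eventually \<open>Z x\<close>, and dominated convergence yields
  \<open>0 \<le> P(A) E Z\<close> by independence. Since \<open>E Z < 0\<close>, this forces \<open>P(A) = 0\<close>.
\<close>
theorem AE_walk_bounded:
  assumes Z: "integrable M Z" and drift: "(\<integral>x. Z x \<partial>M) < 0"
  shows "AE \<omega> in S. \<not> walk_unbounded Z \<omega>"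
proof -
  have [measurable]: "Z \<in> borel_measurable M" using Z by simp
  define A where "A = {\<omega> \<in> space S. walk_unbounded Z \<omega>}"
  have A [measurable]: "A \<in> sets S" unfolding A_def by measurable
  let ?I = "indicator A :: (nat \<Rightarrow> 'a) \<Rightarrow> real"
  let ?W = "reflected_walk Z"
  \<comment> \<open>the increase of the reflected walk caused by prepending the first component, on \<open>A\<close>\<close>
  define s where "s n p = ?I (snd p) * max (- ?W n (snd p)) (Z (fst p))" for n p
  have head_in_A: "case_nat x \<omega> \<in> A \<longleftrightarrow> \<omega> \<in> A" if "x \<in> space M" "\<omega> \<in> space S" for x \<omega>
    using that by (auto simp: A_def walk_unbounded_case_nat space_PiM PiE_iff split: nat.split)
  have int_W: "integrable S (\<lambda>\<omega>. ?I \<omega> * ?W n \<omega>)" for n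
    by (rule Bochner_Integration.integrable_bound[OF integrable_reflected_walk[OF Z, of n]])
      (auto simp: indicator_def)
  have nonneg: "0 \<le> (\<integral>p. s n p \<partial>(M \<Otimes>\<^sub>M S))" for n
  proof -
    have step: "?I \<omega>' * ?W (Suc n) \<omega>' = s n p + ?I (snd p) * ?W n (snd p)"
      if "p \<in> space (M \<Otimes>\<^sub>M S)" "\<omega>' = case_nat (fst p) (snd p)" for p \<omega>'
      using that head_in_A[of "fst p" "snd p"]
      by (auto simp: s_def space_pair_measure indicator_def max_def)
    have int_next: "integrable (M \<Otimes>\<^sub>M S)
        (\<lambda>p. ?I (case_nat (fst p) (snd p)) * ?W (Suc n) (case_nat (fst p) (snd p)))"
      by (subst integral_case_nat(2)) (use int_W[of "Suc n"] in simp_all)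
    have "(\<integral>\<omega>. ?I \<omega> * ?W n \<omega> \<partial>S) \<le> (\<integral>\<omega>. ?I \<omega> * ?W (Suc n) \<omega> \<partial>S)"
      using reflected_walk_mono by (intro integral_mono int_W mult_left_mono) auto
    also have "\<dots> = (\<integral>p. ?I (case_nat (fst p) (snd p)) *
        ?W (Suc n) (case_nat (fst p) (snd p)) \<partial>(M \<Otimes>\<^sub>M S))"
      by (subst integral_case_nat(1)) simp_all
    finally have "0 \<le> (\<integral>p. ?I (case_nat (fst p) (snd p)) *
        ?W (Suc n) (case_nat (fst p) (snd p)) \<partial>(M \<Otimes>\<^sub>M S)) -
        (\<integral>p. ?I (snd p) * ?W n (snd p) \<partial>(M \<Otimes>\<^sub>M S))"
      using integral_tail[OF int_W[of n]] by simp
    also have "\<dots> = (\<integral>p. ?I (case_nat (fst p) (snd p)) *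
        ?W (Suc n) (case_nat (fst p) (snd p)) - ?I (snd p) * ?W n (snd p) \<partial>(M \<Otimes>\<^sub>M S))"
      by (rule Bochner_Integration.integral_diff[symmetric])
        (rule int_next, rule integrable_tail[OF int_W])
    also have "\<dots> = (\<integral>p. s n p \<partial>(M \<Otimes>\<^sub>M S))"
      using step by (intro Bochner_Integration.integral_cong) auto
    finally show ?thesis .
  qed
  have lim: "(\<lambda>n. \<integral>p. s n p \<partial>(M \<Otimes>\<^sub>M S)) \<longlonglongrightarrow> (\<integral>p. ?I (snd p) * Z (fst p) \<partial>(M \<Otimes>\<^sub>M S))"
  proof (rule integral_dominated_convergence[where w = "\<lambda>p. \<bar>Z (fst p)\<bar>"])
    show "integrable (M \<Otimes>\<^sub>M S) (\<lambda>p. \<bar>Z (fst p)\<bar>)"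
      using integrable_head[OF Z] by simp
    show "AE p in M \<Otimes>\<^sub>M S. (\<lambda>n. s n p) \<longlonglongrightarrow> ?I (snd p) * Z (fst p)"
    proof (rule AE_I2)
      fix p
      have "\<forall>\<^sub>F n in sequentially. s n p = ?I (snd p) * Z (fst p)"
      proof (cases "snd p \<in> A")
        case True
        then have "walk_unbounded Z (snd p)" by (simp add: A_def)
        from walk_unbounded_eventually[OF this, of "- Z (fst p)"] show ?thesis
          by eventually_elim (simp add: s_def max_def)
      qed (simp add: s_def)
      then show "(\<lambda>n. s n p) \<longlonglongrightarrow> ?I (snd p) * Z (fst p)"
        by (rule tendsto_eventually)
    qed
    show "AE p in M \<Otimes>\<^sub>M S. norm (s n p) \<le> \<bar>Z (fst p)\<bar>" for n
    proof (rule AE_I2)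
      fix p
      show "norm (s n p) \<le> \<bar>Z (fst p)\<bar>"
        using reflected_walk_nonneg[of Z n "snd p"]
        by (auto simp: s_def indicator_def max_def)
    qed
  qed (simp_all add: s_def[abs_def])
  have "0 \<le> (\<integral>p. ?I (snd p) * Z (fst p) \<partial>(M \<Otimes>\<^sub>M S))"
    by (rule LIMSEQ_le_const[OF lim]) (use nonneg in auto)
  also have "\<dots> = (\<integral>x. \<integral>\<omega>. ?I \<omega> * Z x \<partial>S \<partial>M)"
  proof -
    have "integrable (M \<Otimes>\<^sub>M S) (\<lambda>p. ?I (snd p) * Z (fst p))"
      by (rule Bochner_Integration.integrable_bound[OF integrable_head[OF Z]])
        (auto simp: indicator_def)
    from head_tail.integral_fst'[OF this] show ?thesis by simp
  qed
  also have "\<dots> = measure S A * (\<integral>x. Z x \<partial>M)"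
    using A by simp
  finally have "measure S A = 0"
    using drift by (simp add: zero_le_mult_iff not_le order_antisym_conv)
  then have "emeasure S A = 0" by (simp add: emeasure_eq_measure)
  then show ?thesis
    by (intro AE_I'[of A]) (auto simp: A_def null_sets_def)
qed

corollary AE_partial_sums_bdd_above:
  fixes Z :: "'a \<Rightarrow> real"
  assumes "integrable M Z" "(\<integral>x. Z x \<partial>M) < 0"
  shows "AE \<omega> in S. \<exists>K. \<forall>n. (\<Sum>i<n. Z (\<omega> i)) \<le> K"
  using AE_walk_bounded[OF assms]
proof eventually_elim
  case (elim \<omega>)
  then obtain k :: nat where k: "reflected_walk Z n \<omega> \<le> real k" for n
    unfolding walk_unbounded_def not_all not_ex not_less by blast
  show ?case
    using order_trans[OF partial_sum_le_reflected_walk k] by blast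
qed

end

section \<open>Finite Kullback-Leibler divergence\<close>

text \<open>
  The divergence is defined as an extended real. Its negative part is at most the total mass of
  \<open>f\<close>, since \<open>f0 log (f0 / f) \<ge> f0 - f\<close>; hence a divergence below a real bound has a finite
  positive part too, and is an ordinary expectation of the log ratio under \<open>f0\<close>.
\<close>
lemma KL_less_imp_log_ratio:
  assumes f0: "prob_density \<mu> f0" and f: "prob_density \<mu> f" and less: "KL \<mu> f0 f < ereal c"
  shows "AE x in density \<mu> (\<lambda>x. ennreal (f0 x)). 0 < f x"
    and "integrable (density \<mu> (\<lambda>x. ennreal (f0 x))) (\<lambda>x. ln (f0 x / f x))"
    and "(\<integral>x. ln (f0 x / f x) \<partial>density \<mu> (\<lambda>x. ennreal (f0 x))) < c"
proof -
  have [measurable]: "f0 \<in> borel_measurable \<mu>" "f \<in> borel_measurable \<mu>"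
    and nn: "\<And>x. x \<in> space \<mu> \<Longrightarrow> 0 \<le> f0 x" "\<And>x. x \<in> space \<mu> \<Longrightarrow> 0 \<le> f x"
    and total: "(\<integral>\<^sup>+x. ennreal (f x) \<partial>\<mu>) = 1"
    using f0 f by (auto simp: prob_density_def)
  define g where "g x = f0 x * ln (f0 x / f x)" for x
  have [measurable]: "g \<in> borel_measurable \<mu>" unfolding g_def by measurable
  define p where "p = (\<integral>\<^sup>+x. e2ennreal (KL_integrand f0 f x) \<partial>\<mu>)"
  define q where "q = (\<integral>\<^sup>+x. e2ennreal (- KL_integrand f0 f x) \<partial>\<mu>)"
  have [measurable]: "KL_integrand f0 f \<in> borel_measurable \<mu>"
    unfolding KL_integrand_def[abs_def] by measurable
  have "e2ennreal (- KL_integrand f0 f x) \<le> ennreal (f x)" if x: "x \<in> space \<mu>" for x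
  proof (cases "f0 x = 0 \<or> f x = 0")
    case True
    then show ?thesis by (auto simp: KL_integrand_def e2ennreal_neg)
  next
    case False
    with nn[OF x] have pos: "0 < f0 x" "0 < f x" by auto
    have "- (f0 x * ln (f0 x / f x)) = f0 x * ln (f x / f0 x)"
      using pos by (simp add: ln_div algebra_simps)
    also have "\<dots> \<le> f0 x * (f x / f0 x - 1)"
      using pos by (intro mult_left_mono ln_le_minus_one) auto
    also have "\<dots> \<le> f x" using pos by (simp add: field_simps)
    finally show ?thesis
      using False by (simp add: KL_integrand_def ennreal_leI)
  qed
  then have "q \<le> (\<integral>\<^sup>+x. ennreal (f x) \<partial>\<mu>)"
    unfolding q_def by (rule nn_integral_mono)
  then have q: "q < \<infinity>" unfolding total using le_less_trans by fastforce
  have pq: "enn2ereal p - enn2ereal q < ereal c"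
    using less by (simp add: KL_def p_def q_def)
  then have p: "p < \<infinity>"
    using q by (cases p; cases q) (auto simp: less_top[symmetric])
  have "AE x in \<mu>. e2ennreal (KL_integrand f0 f x) \<noteq> \<infinity>"
    using p unfolding p_def by (intro nn_integral_PInf_AE) auto
  then have pos: "AE x in \<mu>. 0 < f0 x \<longrightarrow> 0 < f x"
    using AE_space
  proof eventually_elim
    case (elim x)
    then show ?case using nn(2)[of x] by (auto simp: KL_integrand_def less_le)
  qed
  have eq: "AE x in \<mu>. KL_integrand f0 f x = ereal (g x)"
    using pos AE_space
  proof eventually_elim
    case (elim x)
    then show ?case using nn(1)[of x] by (auto simp: KL_integrand_def g_def)
  qed
  have p_eq: "p = (\<integral>\<^sup>+x. ennreal (g x) \<partial>\<mu>)"
    unfolding p_def by (rule nn_integral_cong_AE) (use eq in eventually_elim, simp)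
  have q_eq: "q = (\<integral>\<^sup>+x. ennreal (- g x) \<partial>\<mu>)"
    unfolding q_def by (rule nn_integral_cong_AE) (use eq in eventually_elim, simp)
  have int: "integrable \<mu> g"
    using less_imp_neq[OF p] less_imp_neq[OF q] by (simp add: real_integrable_def p_eq q_eq)
  have "integral\<^sup>L \<mu> g = enn2real p - enn2real q"
    by (simp add: real_lebesgue_integral_def[OF int] p_eq q_eq)
  with pq p q have "integral\<^sup>L \<mu> g < c"
    by (cases p; cases q) auto
  then show "(\<integral>x. ln (f0 x / f x) \<partial>density \<mu> (\<lambda>x. ennreal (f0 x))) < c"
    using nn by (subst integral_real_density) (auto simp: g_def[abs_def])
  show "integrable (density \<mu> (\<lambda>x. ennreal (f0 x))) (\<lambda>x. ln (f0 x / f x))"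
    using nn int by (subst integrable_real_density) (auto simp: g_def[abs_def])
  show "AE x in density \<mu> (\<lambda>x. ennreal (f0 x)). 0 < f x"
    using pos by (simp add: AE_density)
qed

section \<open>Evidence and posterior in a dominated model\<close>

text \<open>
  The points of the prior's space are densities, with evaluation measurable jointly in observation
  and density: this makes the likelihood ratio a measurable function of sample and density, as
  Fubini's theorem over samples and densities requires.
\<close>
locale bayesian_model =
  fixes \<mu> :: "'a measure" and prior :: "('a \<Rightarrow> real) measure" and f0 :: "'a \<Rightarrow> real"
  assumes prob_space_prior: "prob_space prior"
    and true_density: "prob_density \<mu> f0"
    and prior_densities: "\<And>f. f \<in> space prior \<Longrightarrow> prob_density \<mu> f"
    and measurable_evaluation: "(\<lambda>(x, f). f x) \<in> borel_measurable (\<mu> \<Otimes>\<^sub>M prior)"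
begin

abbreviation "true_law \<equiv> density \<mu> (\<lambda>x. ennreal (f0 x))"

sublocale prior: prob_space prior
  by (rule prob_space_prior)

lemma f0_measurable [measurable]: "f0 \<in> borel_measurable \<mu>"
  using true_density by (simp add: prob_density_def)

lemma prob_space_true_law: "prob_space true_law"
proof
  show "emeasure true_law (space true_law) = 1"
    using true_density
    by (auto simp: emeasure_density prob_density_def cong: nn_integral_cong)
qed

sublocale iid: sequence_space true_law
proof -
  interpret P0: prob_space true_law by (rule prob_space_true_law)
  show "sequence_space true_law" by unfold_locales
qed

abbreviation "sample \<equiv> sample_measure \<mu> f0"

lemma sample_eq: "sample = iid.S"
  by (simp add: sample_measure_def)

sublocale sample: prob_space sample
  unfolding sample_eq by (rule iid.P.prob_space_axioms)

lemma AE_observations: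
  assumes "AE x in true_law. Q x"
  shows "AE \<omega> in sample. \<forall>i. Q (\<omega> i)"
  unfolding sample_eq AE_all_countable
  by (intro allI AE_PiM_component prob_space_true_law assms) simp

lemma AE_true_density_pos: "AE x in true_law. 0 < f0 x"
  by (simp add: AE_density)

lemma observation_measurable [measurable]: "(\<lambda>\<omega>. \<omega> i) \<in> measurable sample \<mu>"
proof -
  have "(\<lambda>\<omega>. \<omega> i) \<in> measurable sample true_law"
    unfolding sample_eq by (rule measurable_component_singleton) simp
  then show ?thesis by simp
qed

lemma likelihood_ratio_measurable [measurable]:
  "(\<lambda>p. likelihood_ratio f0 n (fst p) (snd p)) \<in> borel_measurable (sample \<Otimes>\<^sub>M prior)"
proof -
  have eval: "(\<lambda>p. snd p (fst p i)) \<in> borel_measurable (sample \<Otimes>\<^sub>M prior)" for i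
  proof -
    have "(\<lambda>p. (fst p i, snd p)) \<in> measurable (sample \<Otimes>\<^sub>M prior) (\<mu> \<Otimes>\<^sub>M prior)"
      by measurable
    from measurable_compose[OF this measurable_evaluation] show ?thesis by simp
  qed
  note eval [measurable]
  show ?thesis unfolding likelihood_ratio_def by measurable
qed

lemma likelihood_ratio_measurable_prior [measurable]:
  assumes "\<omega> \<in> space sample"
  shows "likelihood_ratio f0 n \<omega> \<in> borel_measurable prior"
  using measurable_compose[OF measurable_Pair1'[OF assms] likelihood_ratio_measurable] by simp

text \<open>
  With \<open>c'\<close> strictly between the divergence and \<open>c\<close>, the increments \<open>log (f0 / f) - c'\<close> have
  negative mean, so \<open>- log R\<^sub>n f\<close> is at most \<open>n c' + K\<close> for a random constant \<open>K\<close>. The gap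
  \<open>c - c'\<close> supplies the divergence. Stating it through \<open>liminf\<close> gives a measurable event of the
  pair of sample and density, and the form needed for Fatou's lemma.
\<close>
lemma AE_likelihood_ratio_exceeds:
  assumes f: "f \<in> space prior" and less: "KL \<mu> f0 f < ereal c"
  shows "AE \<omega> in sample.
    liminf (\<lambda>n. ennreal (exp (real n * c)) * ennreal (likelihood_ratio f0 n \<omega> f)) = \<top>"
proof -
  let ?L = "\<lambda>x. ln (f0 x / f x)"
  note log_ratio = KL_less_imp_log_ratio[OF true_density prior_densities[OF f] less]
  obtain c' where c': "(\<integral>x. ?L x \<partial>true_law) < c'" "c' < c"
    using log_ratio(3) dense by blast
  have "AE \<omega> in sample. \<exists>K. \<forall>n. (\<Sum>i<n. ?L (\<omega> i) - c') \<le> K"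
    unfolding sample_eq
    using c'(1) log_ratio(2) by (intro iid.AE_partial_sums_bdd_above) (simp_all add: iid.M.prob_space[simplified])
  with AE_observations[OF log_ratio(1)] AE_observations[OF AE_true_density_pos] show ?thesis
  proof eventually_elim
    case (elim \<omega>)
    from elim(3) obtain K where K: "(\<Sum>i<n. ?L (\<omega> i)) \<le> K + real n * c'" for n
      by (auto simp: sum_subtractf algebra_simps)
    have lower: "exp (real n * (c - c') - K) \<le> exp (real n * c) * likelihood_ratio f0 n \<omega> f" for n
    proof -
      have "likelihood_ratio f0 n \<omega> f = (\<Prod>i<n. exp (- ?L (\<omega> i)))"
        unfolding likelihood_ratio_def using elim(1,2)
        by (intro prod.cong) (simp_all add: exp_minus)
      also have "\<dots> = exp (- (\<Sum>i<n. ?L (\<omega> i)))"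
        by (simp add: exp_sum[symmetric] sum_negf)
      finally show ?thesis
        using K[of n] by (simp add: exp_add[symmetric] algebra_simps)
    qed
    have "filterlim (\<lambda>n. real n * (c - c') - K) at_top sequentially"
      using c'(2) by real_asymp
    then have "filterlim (\<lambda>n. exp (real n * (c - c') - K)) at_top sequentially"
      by (rule filterlim_compose[OF exp_at_top])
    then have "filterlim (\<lambda>n. exp (real n * c) * likelihood_ratio f0 n \<omega> f) at_top sequentially"
      by (rule filterlim_at_top_mono) (simp add: lower)
    then have "(\<lambda>n. ennreal (exp (real n * c) * likelihood_ratio f0 n \<omega> f)) \<longlonglongrightarrow> \<top>"
      by (simp add: ennreal_tendsto_top_eq_at_top)
    then show ?case
      by (intro lim_imp_Liminf) (simp_all add: ennreal_mult')
  qed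
qed

text \<open>
  The exceptional null set of samples depends on \<open>f\<close>. Fubini exchanges the two quantifiers, at the
  price of an exceptional set of \<open>f\<close> of prior mass zero, which the integral over \<open>f\<close> does not see.
\<close>
lemma AE_evidence_exceeds:
  assumes support: "0 < emeasure prior {f \<in> space prior. KL \<mu> f0 f < ereal c}"
  shows "AE \<omega> in sample. liminf (\<lambda>n. ennreal (exp (real n * c)) *
    (\<integral>\<^sup>+f. ennreal (likelihood_ratio f0 n \<omega> f) \<partial>prior)) = \<top>"
proof -
  let ?B = "{f \<in> space prior. KL \<mu> f0 f < ereal c}"
  let ?u = "\<lambda>n \<omega> f. ennreal (exp (real n * c)) * ennreal (likelihood_ratio f0 n \<omega> f)"
  \<comment> \<open>a set outside the \<open>\<sigma>\<close>-algebra has \<open>emeasure\<close> zero, so positivity includes measurability\<close>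
  have B [measurable]: "?B \<in> sets prior"
    using support emeasure_notin_sets[of ?B prior] by fastforce
  interpret pair_prob_space sample prior ..
  have "AE f in prior. AE \<omega> in sample. f \<in> ?B \<longrightarrow> liminf (\<lambda>n. ?u n \<omega> f) = \<top>"
  proof (rule AE_I2)
    fix f assume "f \<in> space prior"
    then show "AE \<omega> in sample. f \<in> ?B \<longrightarrow> liminf (\<lambda>n. ?u n \<omega> f) = \<top>"
      using AE_likelihood_ratio_exceeds[of f c] by (cases "f \<in> ?B") simp_all
  qed
  moreover have "{p \<in> space (sample \<Otimes>\<^sub>M prior).
      snd p \<in> ?B \<longrightarrow> liminf (\<lambda>n. ?u n (fst p) (snd p)) = \<top>} \<in> sets (sample \<Otimes>\<^sub>M prior)"
    by measurable
  ultimately have "AE \<omega> in sample. AE f in prior. f \<in> ?B \<longrightarrow> liminf (\<lambda>n. ?u n \<omega> f) = \<top>"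
    by (subst AE_commute) auto
  then show ?thesis
    using AE_space
  proof eventually_elim
    case (elim \<omega>)
    note [measurable] = likelihood_ratio_measurable_prior[OF elim(2)]
    have "\<top> = (\<integral>\<^sup>+f. \<top> * indicator ?B f \<partial>prior)"
      using support by (subst nn_integral_cmult_indicator[OF B]) (simp add: ennreal_top_mult)
    also have "\<dots> \<le> (\<integral>\<^sup>+f. liminf (\<lambda>n. ?u n \<omega> f) \<partial>prior)"
      using elim(1) by (intro nn_integral_mono_AE) (auto elim!: eventually_mono simp: indicator_def)
    also have "\<dots> \<le> liminf (\<lambda>n. \<integral>\<^sup>+f. ?u n \<omega> f \<partial>prior)"
      by (intro nn_integral_liminf) simp
    finally show ?case
      by (simp add: nn_integral_cmult top_unique)
  qed
qed

text \<open>
  Half of the moment bound \<open>exp (- n \<beta>)\<close> is spent on the threshold for the \<open>\<alpha>\<close>-th power, the other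
  half bounds the probability of exceeding it and makes these probabilities summable. The threshold
  \<open>exp (- n \<beta> / 2)\<close> for the power is \<open>exp (- n \<beta> / (2 \<alpha>))\<close> for the integral itself.
\<close>
lemma AE_set_integral_decays:
  assumes A [measurable]: "A \<in> sets prior" and \<alpha>: "0 < \<alpha>" and \<beta>: "0 < \<beta>"
    and moment: "\<forall>\<^sub>F n in sequentially.
      (\<integral>\<^sup>+\<omega>. ennpowr (\<integral>\<^sup>+f\<in>A. ennreal (likelihood_ratio f0 n \<omega> f) \<partial>prior) \<alpha> \<partial>sample)
        \<le> ennreal (exp (- (real n * \<beta>)))"
  shows "AE \<omega> in sample. \<forall>\<^sub>F n in sequentially.
    (\<integral>\<^sup>+f\<in>A. ennreal (likelihood_ratio f0 n \<omega> f) \<partial>prior)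
      \<le> ennreal (exp (- (real n * (\<beta> / (2 * \<alpha>)))))"
proof -
  define N where "N n \<omega> = (\<integral>\<^sup>+f\<in>A. ennreal (likelihood_ratio f0 n \<omega> f) \<partial>prior)" for n \<omega>
  let ?\<gamma> = "\<beta> / (2 * \<alpha>)"
  have [measurable]: "N n \<in> borel_measurable sample" for n
    unfolding N_def by measurable
  have [measurable]: "(\<lambda>\<omega>. ennpowr (N n \<omega>) \<alpha>) \<in> borel_measurable sample" for n
    unfolding ennpowr_def by measurable
  define Bad where "Bad n = {\<omega> \<in> space sample. ennreal (exp (- (real n * ?\<gamma>))) < N n \<omega>}" for n
  have [measurable]: "Bad n \<in> sets sample" for n
    unfolding Bad_def by measurable
  have bound: "emeasure sample (Bad n) \<le> ennreal (exp (- (real n * (\<beta> / 2))))"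
    if moment_n: "(\<integral>\<^sup>+\<omega>. ennpowr (N n \<omega>) \<alpha> \<partial>sample) \<le> ennreal (exp (- (real n * \<beta>)))" for n
  proof -
    let ?k = "ennreal (exp (real n * (\<beta> / 2)))"
    have "1 \<le> ?k * ennpowr (N n \<omega>) \<alpha>" if "\<omega> \<in> Bad n" for \<omega>
    proof (cases "N n \<omega>")
      case (real t)
      have "exp (- (real n * ?\<gamma>)) < t"
        using that real by (simp add: Bad_def ennreal_less_iff)
      then have "exp (- (real n * ?\<gamma>)) powr \<alpha> \<le> t powr \<alpha>"
        using \<alpha> by (intro powr_mono2) auto
      moreover have "exp (- (real n * ?\<gamma>)) powr \<alpha> = exp (- (real n * (\<beta> / 2)))"
        using \<alpha> by (simp add: powr_def field_simps)
      ultimately have "exp (real n * (\<beta> / 2)) * exp (- (real n * (\<beta> / 2)))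
          \<le> exp (real n * (\<beta> / 2)) * t powr \<alpha>"
        by (intro mult_left_mono) auto
      then show ?thesis
        using real by (simp add: ennpowr_def exp_minus ennreal_mult'[symmetric])
    next
      case top
      then show ?thesis by (simp add: ennpowr_def ennreal_mult_top)
    qed
    then have "emeasure sample (Bad n)
        \<le> emeasure sample {\<omega> \<in> space sample. 1 \<le> ?k * ennpowr (N n \<omega>) \<alpha>}"
      by (intro emeasure_mono) (auto simp: Bad_def)
    also have "\<dots> \<le> ?k * (\<integral>\<^sup>+\<omega>. ennpowr (N n \<omega>) \<alpha> * indicator (space sample) \<omega> \<partial>sample)"
      by (intro nn_integral_Markov_inequality) auto
    also have "\<dots> = ?k * (\<integral>\<^sup>+\<omega>. ennpowr (N n \<omega>) \<alpha> \<partial>sample)"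
      by (simp cong: nn_integral_cong)
    also have "\<dots> \<le> ?k * ennreal (exp (- (real n * \<beta>)))"
      by (intro mult_left_mono moment_n) simp
    also have "\<dots> = ennreal (exp (- (real n * (\<beta> / 2))))"
      by (simp add: ennreal_mult'[symmetric] exp_add[symmetric] field_simps)
    finally show ?thesis .
  qed
  have "summable (\<lambda>n. measure sample (Bad n))"
  proof (rule summable_comparison_test_ev)
    show "\<forall>\<^sub>F n in sequentially. norm (measure sample (Bad n)) \<le> exp (- (\<beta> / 2)) ^ n"
      using moment
    proof eventually_elim
      case (elim n)
      then have "emeasure sample (Bad n) \<le> ennreal (exp (- (real n * (\<beta> / 2))))"
        by (intro bound) (simp add: N_def)
      then show ?case
        by (simp add: sample.emeasure_eq_measure exp_of_nat_mult[symmetric])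
    qed
    show "summable (\<lambda>n. exp (- (\<beta> / 2)) ^ n)"
      using \<beta> by (intro summable_geometric) simp
  qed
  then have "AE \<omega> in sample. \<forall>\<^sub>F n in sequentially. \<omega> \<in> space sample - Bad n"
    by (intro borel_cantelli_AE1) (auto simp: sample.emeasure_eq_measure)
  then show ?thesis
    by (rule AE_mp) (auto intro!: AE_I2 elim!: eventually_mono simp: Bad_def N_def not_less)
qed

text \<open>
  The likelihood of \<open>f0\<close> cancels from the quotient. This needs it to be nonzero, which holds for
  almost every sample because \<open>f0\<close> is positive almost everywhere under its own law.
\<close>
lemma posterior_eq_likelihood_ratio:
  assumes A [measurable]: "A \<in> sets prior" and \<omega>: "\<omega> \<in> space sample" and pos: "\<And>i. 0 < f0 (\<omega> i)"
  shows "posterior prior n \<omega> A =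
    (\<integral>\<^sup>+f\<in>A. ennreal (likelihood_ratio f0 n \<omega> f) \<partial>prior) /
    (\<integral>\<^sup>+f. ennreal (likelihood_ratio f0 n \<omega> f) \<partial>prior)"
proof -
  note [measurable] = likelihood_ratio_measurable_prior[OF \<omega>]
  define L where "L = (\<Prod>i<n. f0 (\<omega> i))"
  have L: "0 < L" unfolding L_def using pos by (intro prod_pos) auto
  have "likelihood n \<omega> f = likelihood_ratio f0 n \<omega> f * L" for f
  proof -
    have "likelihood_ratio f0 n \<omega> f = likelihood n \<omega> f / L"
      by (simp only: likelihood_def likelihood_ratio_def L_def prod_dividef)
    then show ?thesis using L by simp
  qed
  then have eq: "ennreal (likelihood n \<omega> f) = ennreal (likelihood_ratio f0 n \<omega> f) * ennreal L" for f
    using L by (simp add: ennreal_mult'')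
  have "(\<integral>\<^sup>+f\<in>A. ennreal (likelihood n \<omega> f) \<partial>prior) =
      (\<integral>\<^sup>+f. (ennreal (likelihood_ratio f0 n \<omega> f) * indicator A f) * ennreal L \<partial>prior)"
    by (simp add: eq mult_ac)
  also have "\<dots> = (\<integral>\<^sup>+f\<in>A. ennreal (likelihood_ratio f0 n \<omega> f) \<partial>prior) * ennreal L"
    by (rule nn_integral_multc) measurable
  finally have num: "(\<integral>\<^sup>+f\<in>A. ennreal (likelihood n \<omega> f) \<partial>prior) =
      (\<integral>\<^sup>+f\<in>A. ennreal (likelihood_ratio f0 n \<omega> f) \<partial>prior) * ennreal L" .
  have den: "(\<integral>\<^sup>+f. ennreal (likelihood n \<omega> f) \<partial>prior) =
      (\<integral>\<^sup>+f. ennreal (likelihood_ratio f0 n \<omega> f) \<partial>prior) * ennreal L"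
    unfolding eq by (rule nn_integral_multc) measurable
  show ?thesis
    unfolding posterior_def num den using L by (intro divide_mult_eq) auto
qed

text \<open>
  Every rate \<open>b\<close> below \<open>\<gamma> = \<beta> / (2 \<alpha>)\<close> is attained: the evidence costs a factor \<open>exp (n c)\<close>, and
  for \<open>c\<close> equal to half of the gap \<open>\<gamma> - b\<close>, a factor \<open>exp (- n c)\<close> remains.
\<close>
theorem posterior_exponentially_small:
  assumes A: "A \<in> sets prior" and \<alpha>: "0 < \<alpha>" and \<beta>: "0 < \<beta>"
    and moment: "\<forall>\<^sub>F n in sequentially.
      (\<integral>\<^sup>+\<omega>. ennpowr (\<integral>\<^sup>+f\<in>A. ennreal (likelihood_ratio f0 n \<omega> f) \<partial>prior) \<alpha> \<partial>sample)
        \<le> ennreal (exp (- (real n * \<beta>)))"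
    and support: "\<And>c. 0 < c \<Longrightarrow> 0 < emeasure prior {f \<in> space prior. KL \<mu> f0 f < ereal c}"
    and b: "b < \<beta> / (2 * \<alpha>)"
  shows "AE \<omega> in sample. (\<lambda>n. ennreal (exp (real n * b)) * posterior prior n \<omega> A) \<longlonglongrightarrow> 0"
proof -
  define \<gamma> where "\<gamma> = \<beta> / (2 * \<alpha>)"
  define c where "c = (\<gamma> - b) / 2"
  have c: "0 < c" using b by (simp add: c_def \<gamma>_def)
  have "AE \<omega> in sample. \<forall>i. 0 < f0 (\<omega> i)"
    by (rule AE_observations[OF AE_true_density_pos])
  with AE_evidence_exceeds[OF support[OF c]] AE_set_integral_decays[OF A \<alpha> \<beta> moment] AE_space
  show ?thesis
  proof eventually_elim
    case (elim \<omega>)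
    define N where "N n = (\<integral>\<^sup>+f\<in>A. ennreal (likelihood_ratio f0 n \<omega> f) \<partial>prior)" for n
    define D where "D n = (\<integral>\<^sup>+f. ennreal (likelihood_ratio f0 n \<omega> f) \<partial>prior)" for n
    have post: "posterior prior n \<omega> A = N n / D n" for n
      unfolding N_def D_def using elim(4) by (intro posterior_eq_likelihood_ratio A elim(3)) auto
    have "\<forall>\<^sub>F n in sequentially. 1 < ennreal (exp (real n * c)) * D n"
      using elim(1) unfolding D_def by (intro less_LiminfD) simp
    moreover have "\<forall>\<^sub>F n in sequentially. N n \<le> ennreal (exp (- (real n * \<gamma>)))"
      using elim(2) by (simp add: N_def \<gamma>_def)
    ultimately have "\<forall>\<^sub>F n in sequentially.
        ennreal (exp (real n * b)) * posterior prior n \<omega> A \<le> ennreal (exp (- (real n * c)))"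
    proof eventually_elim
      case (elim n)
      let ?e = "ennreal (exp (real n * c))"
      have "N n / D n = (N n * ?e) / (D n * ?e)"
        by (rule divide_mult_eq[symmetric]) auto
      also have "\<dots> \<le> N n * ?e"
      proof (rule divide_le_posI_ennreal)
        show "0 < D n * ?e"
          using elim(1) unfolding mult.commute[of "D n"] by (rule less_trans[OF zero_less_one])
        show "N n * ?e \<le> D n * ?e * (N n * ?e)"
          using mult_right_mono[OF less_imp_le[OF elim(1)], of "N n * ?e"]
          unfolding mult.commute[of "D n"] mult_1 by simp
      qed
      also have "\<dots> \<le> ennreal (exp (- (real n * \<gamma>))) * ?e"
        by (intro mult_right_mono elim(2)) simp
      finally have "ennreal (exp (real n * b)) * posterior prior n \<omega> A \<le>
          ennreal (exp (real n * b)) * (ennreal (exp (- (real n * \<gamma>))) * ?e)"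
        unfolding post by (intro mult_left_mono) auto
      also have "\<dots> = ennreal (exp (- (real n * c)))"
        by (simp add: ennreal_mult'[symmetric] exp_add[symmetric] c_def field_simps)
      finally show ?case .
    qed
    moreover have "(\<lambda>n. ennreal (exp (- (real n * c)))) \<longlonglongrightarrow> 0"
    proof -
      have "(\<lambda>n. exp (- c) ^ n) \<longlonglongrightarrow> 0"
        using c by (intro LIMSEQ_realpow_zero) auto
      then have "(\<lambda>n. ennreal (exp (- (real n * c)))) \<longlonglongrightarrow> ennreal 0"
        by (intro tendsto_ennrealI) (simp add: exp_of_nat_mult[symmetric])
      then show ?thesis by simp
    qed
    ultimately show ?case
      by (rule tendsto_sandwich[OF always_eventually[OF allI[OF zero_le]] _ tendsto_const])
  qed
qed

end

section \<open>Exponential consistency of the posterior\<close>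

theorem corollary2:
  fixes \<mu> :: "'a::polish_space measure"
    and F :: "('a \<Rightarrow> real) set"
    and prior :: "('a \<Rightarrow> real) measure"
    and f0 :: "'a \<Rightarrow> real"
    and d :: "('a \<Rightarrow> real) \<Rightarrow> ('a \<Rightarrow> real) \<Rightarrow> real"
    and r :: real
  assumes "sigma_finite_measure \<mu>"
    and "space \<mu> = UNIV"
    and "density_versions \<mu> F"
    and "separable_space (hellinger_topology \<mu> F)"
    and "(\<lambda>(x, f). f x) \<in> borel_measurable (\<mu> \<Otimes>\<^sub>M hellinger_borel \<mu> F)"
    and "prob_space prior"
    and "sets prior = sets (hellinger_borel \<mu> F)"
    and "f0 \<in> F"
    and "Metric_space F d"
    and "\<And>t. t > 0 \<Longrightarrow> {f\<in>F. d f f0 \<ge> t} \<in> sets (hellinger_borel \<mu> F)"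
    and "r > 0"
    and "in_KL_support \<mu> F prior f0"
    and "\<And>\<epsilon>::real. \<epsilon> > 0 \<Longrightarrow> \<exists>\<alpha> \<beta>. 0 < \<alpha> \<and> \<alpha> \<le> 1 \<and> \<beta> > 0 \<and>
           (\<forall>\<^sub>F n in sequentially.
              (\<integral>\<^sup>+\<omega>. ennpowr
                  (\<integral>\<^sup>+f\<in>{f\<in>F. d f f0 \<ge> r * \<epsilon>}. ennreal (likelihood_ratio f0 n \<omega> f) \<partial>prior) \<alpha>
                \<partial>sample_measure \<mu> f0)
              \<le> ennreal (exp (- (real n * \<beta>))))"
  shows "\<forall>\<epsilon>>0::real. \<exists>b>0::real. AE \<omega> in sample_measure \<mu> f0.
           (\<lambda>n. ennreal (exp (real n * b)) * posterior prior n \<omega> {f\<in>F. d f f0 \<ge> \<epsilon>}) \<longlonglongrightarrow> 0"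
proof (intro allI impI)
  fix \<epsilon> :: real assume \<epsilon>: "0 < \<epsilon>"
  have space_prior: "space prior = F"
    using sets_eq_imp_space_eq[OF assms(7)]
    by (simp add: hellinger_borel_def space_measure_of_conv)
  interpret bayesian_model \<mu> prior f0
  proof (rule bayesian_model.intro)
    show "prob_space prior" by (rule assms(6))
    show "prob_density \<mu> f0"
      using assms(3,8) by (simp add: density_versions_def)
    show "prob_density \<mu> f" if "f \<in> space prior" for f
      using assms(3) that by (simp add: density_versions_def space_prior)
    have "sets (\<mu> \<Otimes>\<^sub>M prior) = sets (\<mu> \<Otimes>\<^sub>M hellinger_borel \<mu> F)"
      by (intro sets_pair_measure_cong refl assms(7))
    then show "(\<lambda>(x, f). f x) \<in> borel_measurable (\<mu> \<Otimes>\<^sub>M prior)"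
      using assms(5) by (simp cong: measurable_cong_sets)
  qed
  let ?A = "{f \<in> F. d f f0 \<ge> \<epsilon>}"
  \<comment> \<open>applying the moment hypothesis with \<open>\<epsilon> / r\<close> absorbs the constant \<open>r\<close>\<close>
  have radius: "r * (\<epsilon> / r) = \<epsilon>" using assms(11) by simp
  have "0 < \<epsilon> / r" using \<epsilon> assms(11) by simp
  from assms(13)[OF this, unfolded radius] obtain \<alpha> \<beta> where \<alpha>: "0 < \<alpha>" and \<beta>: "0 < \<beta>"
    and moment: "\<forall>\<^sub>F n in sequentially.
      (\<integral>\<^sup>+\<omega>. ennpowr (\<integral>\<^sup>+f\<in>?A. ennreal (likelihood_ratio f0 n \<omega> f) \<partial>prior) \<alpha> \<partial>sample)
        \<le> ennreal (exp (- (real n * \<beta>)))"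
    by blast
  have A: "?A \<in> sets prior" using assms(10)[OF \<epsilon>] assms(7) by simp
  have support: "0 < emeasure prior {f \<in> space prior. KL \<mu> f0 f < ereal c}" if "0 < c" for c
    using assms(12) that by (simp add: in_KL_support_def space_prior)
  show "\<exists>b>0. AE \<omega> in sample.
      (\<lambda>n. ennreal (exp (real n * b)) * posterior prior n \<omega> ?A) \<longlonglongrightarrow> 0"
    using \<alpha> \<beta> by (intro exI[of _ "\<beta> / (4 * \<alpha>)"] conjI
        posterior_exponentially_small[OF A \<alpha> \<beta> moment support]) (simp_all add: field_simps)
qed

end
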